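(* For any multitype Galton--Watson branching process with countable typeset $\mathcal X$, and any $A\subseteq\mathcal X$ such that $\boldsymbol q(A)\ne\boldsymbol q$, one has $\sup_{x\in\mathcal X}q_x(A)=1$.
   Context: A multitype Galton--Watson branching process (MGWBP) $\{\boldsymbol Z_n\}_{n\ge0}$ with countable (finite or countably infinite) typeset $\mathcal X$: $\boldsymbol Z_n=(Z_{n,x})_{x\in\mathcal X}$, where $Z_{n,x}$ is the number of type-$x$ individuals in generation $n$; each individual lives for one generation and at death, independently of all others, gives birth to a finite random number of offspring of various types, with a joint law depending only on its type. $\mathbb P_x$ denotes the law of the process started from a single type-$x$ individual. For $A\subseteq\mathcal X$, $\mathcal E(A)$ is the event $\lim_{n\to\infty}\sum_{x\in A}Z_{n,x}=0$ (extinction in $A$), $\boldsymbol q(A)=(q_x(A))_{x\in\mathcal X}$ with $q_x(A)=\mathbb P_x(\mathcal E(A))$, and $\boldsymbol q=\boldsymbol q(\mathcal X)$. *)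

theory Defs
  imports "HOL-Probability.Probability"
begin

text \<open>
  A generation is a multiset of types, i.e. a finitely supported vector of counts, so
  \<open>Z\<^sub>n\<^sub>,\<^sub>x\<close> is \<open>count (Z n \<omega>) x\<close>.
  \<open>P x\<close> is the probability measure under which the process starts from a single individual of
  type \<open>x\<close>, \<open>p y\<close> is the joint offspring law of a type-\<open>y\<close> individual, and \<open>\<xi> n y i\<close> is the
  offspring of the \<open>i\<close>-th type-\<open>y\<close> individual of generation \<open>n\<close>; it is defined for all \<open>i\<close>, but only
  those with \<open>i < count (Z n \<omega>) y\<close> are used.
\<close>

locale mgwbp =
  fixes P :: "'x::countable \<Rightarrow> 'w measure"
    and p :: "'x \<Rightarrow> 'x multiset pmf"
    and \<xi> :: "nat \<Rightarrow> 'x \<Rightarrow> nat \<Rightarrow> 'w \<Rightarrow> 'x multiset"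
    and Z :: "nat \<Rightarrow> 'w \<Rightarrow> 'x multiset"
  assumes prob_space_P: "prob_space (P x)"
    and offspring_indep:
      "prob_space.indep_vars (P x) (\<lambda>_. count_space UNIV) (\<lambda>(n, y, i). \<xi> n y i) UNIV"
    and offspring_law: "distr (P x) (count_space UNIV) (\<xi> n y i) = measure_pmf (p y)"
    and measurable_Z: "Z n \<in> measurable (P x) (count_space UNIV)"
    and Z_0: "AE \<omega> in P x. Z 0 \<omega> = {#x#}"
    and Z_Suc: "AE \<omega> in P x. Z (Suc n) \<omega> =
      (\<Sum>y\<in>set_mset (Z n \<omega>). \<Sum>i<count (Z n \<omega>) y. \<xi> n y i \<omega>)"

definition extinct :: "(nat \<Rightarrow> 'w \<Rightarrow> 'x multiset) \<Rightarrow> 'x set \<Rightarrow> 'w \<Rightarrow> bool" where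
  "extinct Z A \<omega> \<longleftrightarrow> (\<lambda>n. \<Sum>\<^sub>\<infinity>x\<in>A. real (count (Z n \<omega>) x)) \<longlonglongrightarrow> 0"

definition ext_prob ::
    "('x \<Rightarrow> 'w measure) \<Rightarrow> (nat \<Rightarrow> 'w \<Rightarrow> 'x multiset) \<Rightarrow> 'x set \<Rightarrow> 'x \<Rightarrow> real" where
  "ext_prob P Z A x = measure (P x) {\<omega> \<in> space (P x). extinct Z A \<omega>}"

lemma infsum_count: "(\<Sum>\<^sub>\<infinity>x\<in>A. real (count m x)) = real (size {#x \<in># m. x \<in> A#})"
proof -
  have "(\<Sum>\<^sub>\<infinity>x\<in>A. real (count m x)) = (\<Sum>\<^sub>\<infinity>x\<in>{x. x \<in># m \<and> x \<in> A}. real (count m x))"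
    by (rule infsum_cong_neutral) (auto simp: not_in_iff)
  also have "\<dots> = (\<Sum>x\<in>{x. x \<in># m \<and> x \<in> A}. real (count m x))"
    by (rule infsum_finite) auto
  also have "\<dots> = real (size {#x \<in># m. x \<in> A#})"
    by (simp add: size_multiset_overloaded_eq)
  finally show ?thesis .
qed

lemma countable_UNIV_multiset: "countable (UNIV :: 'x::countable multiset set)"
  by (metis countableI_type countable_image surj_mset)

lemma extinct_iff: "extinct Z A \<omega> \<longleftrightarrow> (\<exists>N. \<forall>n\<ge>N. \<forall>x\<in>A. count (Z n \<omega>) x = 0)"
proof -
  let ?S = "\<lambda>n. size {#x \<in># Z n \<omega>. x \<in> A#}"
  have "extinct Z A \<omega> \<longleftrightarrow> (\<lambda>n. real (?S n)) \<longlonglongrightarrow> 0"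
    by (simp add: extinct_def infsum_count)
  also have "\<dots> \<longleftrightarrow> (\<forall>\<^sub>F n in sequentially. ?S n = 0)"
  proof
    assume "(\<lambda>n. real (?S n)) \<longlonglongrightarrow> 0"
    then have "\<forall>\<^sub>F n in sequentially. real (?S n) < 1"
      by (rule order_tendstoD) simp
    then show "\<forall>\<^sub>F n in sequentially. ?S n = 0"
      by (rule eventually_mono) linarith
  next
    assume "\<forall>\<^sub>F n in sequentially. ?S n = 0"
    then have "\<forall>\<^sub>F n in sequentially. real (?S n) = 0"
      by (rule eventually_mono) simp
    then show "(\<lambda>n. real (?S n)) \<longlonglongrightarrow> 0"
      by (rule tendsto_eventually)
  qed
  also have "\<dots> \<longleftrightarrow> (\<exists>N. \<forall>n\<ge>N. \<forall>x\<in>A. count (Z n \<omega>) x = 0)"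
    by (simp add: eventually_sequentially multiset_eq_iff) (metis count_eq_zero_iff)
  finally show ?thesis .
qed

lemma (in mgwbp) extinct_in_sets: "{\<omega> \<in> space (P x). extinct Z A \<omega>} \<in> sets (P x)"
proof -
  note measurable_Z[measurable]
  have "Measurable.pred (P x) (\<lambda>\<omega>. \<forall>y\<in>A. count (Z n \<omega>) y = 0)" for n
    by (rule measurable_compose[OF measurable_Z]) simp
  then have "Measurable.pred (P x) (\<lambda>\<omega>. \<exists>N. \<forall>n\<ge>N. \<forall>y\<in>A. count (Z n \<omega>) y = 0)"
    by measurable
  then show ?thesis by (simp add: extinct_iff pred_def)
qed

text \<open>Every family of offspring laws is realised by such a process: take the \<open>Some\<close>-coordinates of a
  product space as the offspring variables and the \<open>None\<close>-coordinate as the first generation.\<close>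

fun canonical_Z ::
    "nat \<Rightarrow> ((nat \<times> 'x \<times> nat) option \<Rightarrow> 'x multiset) \<Rightarrow> 'x multiset" where
  "canonical_Z 0 \<omega> = \<omega> None"
| "canonical_Z (Suc n) \<omega> = (\<Sum>y\<in>set_mset (canonical_Z n \<omega>).
     \<Sum>i<count (canonical_Z n \<omega>) y. \<omega> (Some (n, y, i)))"

lemma mgwbp_exists:
  fixes p :: "'x::countable \<Rightarrow> 'x multiset pmf"
  defines "p' \<equiv> \<lambda>x k. case k of None \<Rightarrow> return_pmf {#x#} | Some (n, y, i) \<Rightarrow> p y"
  shows "mgwbp (\<lambda>x. PiM UNIV (\<lambda>k. measure_pmf (p' x k))) p (\<lambda>n y i \<omega>. \<omega> (Some (n, y, i))) canonical_Z"
proof (rule mgwbp.intro)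
  fix x :: 'x and n i :: nat and y :: 'x
  let ?M = "PiM UNIV (\<lambda>k. measure_pmf (p' x k))"
  interpret product_prob_space "\<lambda>k. measure_pmf (p' x k)" UNIV
    by unfold_locales
  have comp: "(\<lambda>\<omega>. \<omega> k) \<in> measurable ?M (count_space UNIV)" for k
    using measurable_component_singleton[of k UNIV "\<lambda>k. measure_pmf (p' x k)"] by simp
  have distr: "distr ?M (count_space UNIV) (\<lambda>\<omega>. \<omega> k) = measure_pmf (p' x k)" for k
  proof -
    have "distr ?M (count_space UNIV) (\<lambda>\<omega>. \<omega> k) = distr ?M (measure_pmf (p' x k)) (\<lambda>\<omega>. \<omega> k)"
      by (rule distr_cong) auto
    then show ?thesis by (simp add: PiM_component)
  qed
  show "prob_space ?M" by (rule P.prob_space_axioms)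
  show "distr ?M (count_space UNIV) (\<lambda>\<omega>. \<omega> (Some (n, y, i))) = measure_pmf (p y)"
    using distr[of "Some (n, y, i)"] by (simp add: p'_def)
  show "P.indep_vars (\<lambda>_. count_space UNIV) (\<lambda>(n, y, i) \<omega>. \<omega> (Some (n, y, i))) UNIV"
  proof -
    let ?t = "Some :: nat \<times> 'x \<times> nat \<Rightarrow> _" and ?C = "\<lambda>_. count_space (UNIV :: 'x multiset set)"
    have "distr ?M (PiM UNIV ?C) (\<lambda>\<omega>. \<lambda>k\<in>UNIV. \<omega> (?t k)) =
        distr ?M (PiM UNIV (\<lambda>k. measure_pmf (p' x (?t k)))) (\<lambda>\<omega>. \<lambda>k\<in>UNIV. \<omega> (?t k))"
      by (intro distr_cong sets_PiM_cong) auto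
    also have "\<dots> = PiM UNIV (\<lambda>k. measure_pmf (p' x (?t k)))"
      by (intro distr_PiM_reindex) (auto intro: measure_pmf.prob_space_axioms)
    finally have "P.indep_vars ?C (\<lambda>k \<omega>. \<omega> (?t k)) UNIV"
      using comp by (subst P.indep_vars_iff_distr_eq_PiM') (auto simp: distr)
    then show ?thesis by (simp add: case_prod_unfold)
  qed
  show "canonical_Z n \<in> measurable ?M (count_space UNIV)"
  proof (induction n)
    case 0
    then show ?case using comp by simp
  next
    case (Suc n)
    have sum: "(\<lambda>\<omega>. \<Sum>a\<in>S. f a \<omega>) \<in> measurable ?M (count_space UNIV)"
      if "\<And>a. f a \<in> measurable ?M (count_space UNIV)" "finite S"
      for f :: "'b \<Rightarrow> _ \<Rightarrow> 'x multiset" and S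
      using that(2)
    proof induction
      case (insert a S)
      have "(\<lambda>\<omega>. f a \<omega> + (\<Sum>a\<in>S. f a \<omega>)) \<in> measurable ?M (count_space UNIV)"
        by (rule measurable_compose_countable'[OF _ that(1)[of a] countable_UNIV_multiset],
            rule measurable_compose[OF insert.IH]) simp
      then show ?case using insert by simp
    qed simp
    show ?case
      unfolding canonical_Z.simps
      by (rule measurable_compose_countable'[OF _ Suc countable_UNIV_multiset,
            where f="\<lambda>m \<omega>. \<Sum>y\<in>set_mset m. \<Sum>i<count m y. \<omega> (Some (n, y, i))"])
         (intro sum comp; simp)
  qed
  have "AE m in measure_pmf (p' x None). m = {#x#}"
    by (simp add: p'_def AE_measure_pmf_iff)
  then show "AE \<omega> in ?M. canonical_Z 0 \<omega> = {#x#}"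
    using AE_component[of None "\<lambda>m. m = {#x#}"] by simp
qed simp

end

theory Submission
  imports Defs
begin

text \<open>
  Let \<open>c = sup\<^sub>x q\<^sub>x(A) < 1\<close>. Fix \<open>N\<close> and let \<open>F\<close> be the event that the process survives but has no
  individual with type in \<open>A\<close> from generation \<open>N\<close> on. It is the decreasing limit of the events
  \<open>B\<^sub>M\<close> that the process is alive at time \<open>M \<ge> N\<close> and avoids \<open>A\<close> in the generations \<open>N, \<dots>, M\<close>.
  By the Markov property at time \<open>M\<close>, and since the descendants of a single individual of generation
  \<open>M\<close> avoid \<open>A\<close> forever with probability at most \<open>c\<close>, the probability of \<open>F\<close> is at most
  \<open>c\<close> times that of \<open>B\<^sub>M\<close>. Letting \<open>M \<rightarrow> \<infinity>\<close> shows that \<open>F\<close> is null. Hence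
  extinction in \<open>A\<close> almost surely implies global extinction, that is, \<open>q(A) = q\<close>.
\<close>

section \<open>The process as a deterministic function of its offspring variables\<close>

definition offspring :: "'x multiset \<Rightarrow> ('x \<times> nat \<Rightarrow> 'x multiset) \<Rightarrow> 'x multiset" where
  "offspring z e = (\<Sum>y\<in>set_mset z. \<Sum>i<count z y. e (y, i))"

text \<open>\<open>w n\<close> carries the offspring of every potential individual of generation
  \<open>n\<close>, so processes with different starting multisets \<open>z\<close> are coupled
  through one \<open>w\<close>.\<close>

primrec gw :: "'x multiset \<Rightarrow> nat \<Rightarrow> (nat \<Rightarrow> 'x \<times> nat \<Rightarrow> 'x multiset) \<Rightarrow> 'x multiset" where
  "gw z 0 w = z"
| "gw z (Suc n) w = offspring (gw z n w) (w n)"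

definition gen_space :: "('x \<Rightarrow> 'x multiset pmf) \<Rightarrow> ('x \<times> nat \<Rightarrow> 'x multiset) measure" where
  "gen_space p = PiM UNIV (\<lambda>(y, i). measure_pmf (p y))"

text \<open>Grouping the variables by generation gives a sequence of i.i.d. coordinates, in which
  past and future can be spliced by \<open>comb_seq\<close>.\<close>

definition path_space ::
    "('x \<Rightarrow> 'x multiset pmf) \<Rightarrow> (nat \<Rightarrow> 'x \<times> nat \<Rightarrow> 'x multiset) measure" where
  "path_space p = PiM UNIV (\<lambda>_. gen_space p)"

text \<open>The individuals \<open>(y, i)\<close> of \<open>z\<close> are also individuals of
  \<open>z'\<close>, with the same offspring \<open>e (y, i)\<close>.\<close>

lemma offspring_mono:
  assumes "z \<subseteq># z'"
  shows "offspring z e \<subseteq># offspring z' e"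
proof (rule mset_subset_eqI)
  fix a
  have le: "count z y \<le> count z' y" for y
    using assms by (simp add: subseteq_mset_def)
  have "(\<Sum>y\<in>set_mset z. \<Sum>i<count z y. count (e (y, i)) a) \<le>
      (\<Sum>y\<in>set_mset z. \<Sum>i<count z' y. count (e (y, i)) a)"
    using le by (intro sum_mono sum_mono2) (auto intro: less_le_trans)
  also have "\<dots> \<le> (\<Sum>y\<in>set_mset z'. \<Sum>i<count z' y. count (e (y, i)) a)"
    using set_mset_mono[OF assms] by (intro sum_mono2) auto
  finally show "count (offspring z e) a \<le> count (offspring z' e) a"
    by (simp add: offspring_def count_sum)
qed

lemma gw_mono: "z \<subseteq># z' \<Longrightarrow> gw z n w \<subseteq># gw z' n w"
  by (induction n) (auto intro: offspring_mono)

lemma gw_empty: "gw z n w = {#} \<Longrightarrow> n \<le> m \<Longrightarrow> gw z m w = {#}"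
  by (induction m) (auto simp: offspring_def le_Suc_eq)

text \<open>Generation \<open>n\<close> uses only the entries \<open>w i\<close> with
  \<open>i < n\<close>; hence the case \<open>n = m\<close> is included.\<close>

lemma gw_comb_seq_le: "n \<le> m \<Longrightarrow> gw z n (comb_seq m w w') = gw z n w"
  by (induction n) (auto simp: comb_seq_def)

text \<open>The pathwise form of the Markov property: after \<open>m\<close> generations driven by
  \<open>w\<close>, the process restarts from its current state, driven by
  \<open>w'\<close>.\<close>

lemma gw_comb_seq_add: "gw z (m + k) (comb_seq m w w') = gw (gw z m w) k w'"
proof -
  have "comb_seq m w w' (m + k) = w' k" for k
    by (simp add: comb_seq_def)
  then show ?thesis
    by (induction k) (simp_all add: gw_comb_seq_le)
qed

section \<open>Probability and measurability on the path space\<close>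

lemma prob_space_gen_space: "prob_space (gen_space p)"
  unfolding gen_space_def
  by (rule prob_space_PiM) (auto split: prod.split intro: measure_pmf.prob_space_axioms)

lemma prob_space_path_space: "prob_space (path_space p)"
  unfolding path_space_def by (intro prob_space_PiM prob_space_gen_space)

lemma space_gen_space [simp]: "space (gen_space p) = UNIV"
  by (auto simp: gen_space_def space_PiM split: prod.split)

lemma space_path_space [simp]: "space (path_space p) = UNIV"
  by (auto simp: path_space_def space_PiM)

lemma sets_gen_space: "sets (gen_space p) = sets (PiM UNIV (\<lambda>_. count_space UNIV))"
  unfolding gen_space_def by (intro sets_PiM_cong) (auto split: prod.split)

lemma measurable_sum_mset:
  fixes f :: "'i \<Rightarrow> 'a \<Rightarrow> 'x::countable multiset"
  assumes "\<And>a. a \<in> S \<Longrightarrow> f a \<in> measurable M (count_space UNIV)"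
  shows "(\<lambda>w. \<Sum>a\<in>S. f a w) \<in> measurable M (count_space UNIV)"
  using assms
proof (induction S rule: infinite_finite_induct)
  case (insert a S)
  have "(\<lambda>w. f a w + (\<Sum>a\<in>S. f a w)) \<in> measurable M (count_space UNIV)"
  \<comment> \<open>There are only countably many multisets, so the value \<open>m\<close> of the
    first summand can be frozen.\<close>
  proof (rule measurable_compose_countable'[OF _ _ countable_UNIV_multiset,
        where f = "\<lambda>m w. m + (\<Sum>a\<in>S. f a w)" and g = "f a"])
    show "f a \<in> measurable M (count_space UNIV)"
      by (simp add: insert.prems)
    show "(\<lambda>w. m + (\<Sum>a\<in>S. f a w)) \<in> measurable M (count_space UNIV)" for m
      by (rule measurable_compose[OF insert.IH]) (simp_all add: insert.prems)
  qed
  then show ?case using insert by simp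
qed simp_all

lemma measurable_offspring:
  fixes p :: "'x::countable \<Rightarrow> 'x multiset pmf"
  shows "offspring z \<in> measurable (gen_space p) (count_space UNIV)"
proof -
  have "(\<lambda>e. e k) \<in> measurable (gen_space p) (count_space UNIV)" for k
    unfolding measurable_cong_sets[OF sets_gen_space refl] by simp
  then show ?thesis
    unfolding offspring_def[abs_def] by (intro measurable_sum_mset)
qed

lemma measurable_gw:
  fixes p :: "'x::countable \<Rightarrow> 'x multiset pmf"
  shows "gw z n \<in> measurable (path_space p) (count_space UNIV)"
proof (induction n)
  case (Suc n)
  have "(\<lambda>w. w n) \<in> measurable (path_space p) (gen_space p)"
    by (simp add: path_space_def)
  then have "(\<lambda>w. offspring m (w n)) \<in> measurable (path_space p) (count_space UNIV)" for m
    using measurable_offspring by (rule measurable_compose)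
  then have "(\<lambda>w. offspring (gw z n w) (w n)) \<in> measurable (path_space p) (count_space UNIV)"
    by (rule measurable_compose_countable'[OF _ Suc countable_UNIV_multiset])
  then show ?case by simp
qed simp

lemma pred_gw [measurable]:
  fixes p :: "'x::countable \<Rightarrow> 'x multiset pmf"
  shows "Measurable.pred (path_space p) (\<lambda>w. Q (gw z n w))"
  by (rule measurable_compose[OF measurable_gw]) simp

lemma sets_gw_ball:
  fixes p :: "'x::countable \<Rightarrow> 'x multiset pmf"
  shows "{w. \<forall>n. R n \<longrightarrow> Q (gw z n w)} \<in> sets (path_space p)"
proof -
  have "Measurable.pred (path_space p) (\<lambda>w. \<forall>n. R n \<longrightarrow> Q (gw z n w))"
    by measurable
  then show ?thesis by (simp add: pred_def)
qed

section \<open>The Markov property and surviving while avoiding \<open>A\<close>\<close>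

text \<open>A path splits into independent parts, the past \<open>w\<close> and the future
  \<open>w'\<close>. By \<open>D_past\<close>, \<open>D\<close> depends on the past alone;
  integrating the conditional bound \<open>c\<close> over the pasts in \<open>D\<close> gives the
  product.\<close>

lemma markov_bound:
  fixes p :: "'x::countable \<Rightarrow> 'x multiset pmf" and B :: "'x multiset set"
  assumes B: "{w. D w} \<in> sets (path_space p)"
    and D_past: "\<And>w w'. D (comb_seq m w w') \<longleftrightarrow> D w"
    and bound: "\<And>w. D w \<Longrightarrow> measure (path_space p) {w'. \<forall>k. gw (gw z m w) k w' \<in> B} \<le> c"
  shows "measure (path_space p) {w. D w \<and> (\<forall>k. gw z (m + k) w \<in> B)}
    \<le> c * measure (path_space p) {w. D w}"
proof -
  let ?S = "path_space p"
  interpret S: prob_space ?S by (rule prob_space_path_space)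
  interpret prob_space "gen_space p" by (rule prob_space_gen_space)
  interpret seq: sequence_space "gen_space p" by unfold_locales
  have "{w. \<forall>n. n \<ge> m \<longrightarrow> gw z n w \<in> B} \<in> sets ?S"
    by (rule sets_gw_ball)
  moreover have "{w. \<forall>n. n \<ge> m \<longrightarrow> gw z n w \<in> B} = {w. \<forall>k. gw z (m + k) w \<in> B}"
    by (auto simp: le_iff_add)
  ultimately have E: "{w. D w \<and> (\<forall>k. gw z (m + k) w \<in> B)} \<in> sets ?S"
    using B by (simp add: Collect_conj_eq)
  let ?E = "{w. D w \<and> (\<forall>k. gw z (m + k) w \<in> B)}"
  let ?f = "\<lambda>(w, w'). comb_seq m w w'"
  have f: "?f \<in> measurable (?S \<Otimes>\<^sub>M ?S) ?S"
    unfolding path_space_def by (rule measurable_comb_seq)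
  \<comment> \<open>Nonnegativity of \<open>c\<close>, which turns \<open>ennreal c\<close> back
    into a real, is read off at any path in \<open>D\<close>; if there is none, both sides of the
    claim are 0.\<close>
  have c: "0 \<le> c" if "D w" for w
    using bound[OF that] by (rule order_trans[OF measure_nonneg])
  have "emeasure ?S ?E = emeasure (distr (?S \<Otimes>\<^sub>M ?S) ?S ?f) ?E"
    using seq.PiM_comb_seq[of m] by (simp add: path_space_def)
  also have "\<dots> = emeasure (?S \<Otimes>\<^sub>M ?S) (?f -` ?E \<inter> space (?S \<Otimes>\<^sub>M ?S))"
    by (rule emeasure_distr[OF f E])
  also have "\<dots> = (\<integral>\<^sup>+w. emeasure ?S (Pair w -` (?f -` ?E \<inter> space (?S \<Otimes>\<^sub>M ?S))) \<partial>?S)"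
    by (rule S.emeasure_pair_measure_alt[OF measurable_sets[OF f E]])
  also have "\<dots> \<le> (\<integral>\<^sup>+w. ennreal c * indicator {w. D w} w \<partial>?S)"
  proof (rule nn_integral_mono)
    fix w
    have "Pair w -` (?f -` ?E \<inter> space (?S \<Otimes>\<^sub>M ?S)) =
        {w'. D w \<and> (\<forall>k. gw (gw z m w) k w' \<in> B)}"
      by (auto simp: space_pair_measure D_past gw_comb_seq_add)
    then show "emeasure ?S (Pair w -` (?f -` ?E \<inter> space (?S \<Otimes>\<^sub>M ?S)))
        \<le> ennreal c * indicator {w. D w} w"
      using bound[of w] by (cases "D w") (auto simp: S.emeasure_eq_measure intro!: ennreal_leI)
  qed
  also have "\<dots> = ennreal c * emeasure ?S {w. D w}"
    using B by (rule nn_integral_cmult_indicator)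
  finally have le: "emeasure ?S ?E \<le> ennreal c * emeasure ?S {w. D w}" .
  show ?thesis
  proof (cases "\<exists>w. D w")
    case True
    with le c show ?thesis
      by (auto simp: S.emeasure_eq_measure ennreal_mult[symmetric])
  qed simp
qed

lemma measure_survive_avoid_eq_0:
  fixes p :: "'x::countable \<Rightarrow> 'x multiset pmf"
  assumes bound: "\<And>y. measure (path_space p) {w. \<forall>k. set_mset (gw {#y#} k w) \<inter> A = {}} \<le> c"
    and "c < 1"
  shows "measure (path_space p)
    {w. (\<forall>n. gw z n w \<noteq> {#}) \<and> (\<forall>n\<ge>N. set_mset (gw z n w) \<inter> A = {})} = 0"
proof -
  let ?S = "path_space p"
  interpret S: prob_space ?S by (rule prob_space_path_space)
  \<comment> \<open>\<open>D j\<close> is the event \<open>B\<^sub>M\<close> with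
    \<open>M = N + j\<close>. Being alive at time \<open>M\<close> already implies being alive at
    all earlier times.\<close>
  define D where "D j w \<longleftrightarrow> gw z (N + j) w \<noteq> {#} \<and>
    (\<forall>n. N \<le> n \<and> n \<le> N + j \<longrightarrow> set_mset (gw z n w) \<inter> A = {})" for j w
  let ?F = "{w. (\<forall>n. gw z n w \<noteq> {#}) \<and> (\<forall>n\<ge>N. set_mset (gw z n w) \<inter> A = {})}"
  have D_sets: "{w. D j w} \<in> sets ?S" for j
  proof -
    have "{w. \<forall>n. N \<le> n \<and> n \<le> N + j \<longrightarrow> set_mset (gw z n w) \<inter> A = {}} \<in> sets ?S"
      by (rule sets_gw_ball)
    moreover have "{w. \<forall>n. n = N + j \<longrightarrow> gw z n w \<noteq> {#}} \<in> sets ?S"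
      by (rule sets_gw_ball)
    ultimately show ?thesis by (simp add: D_def Collect_conj_eq)
  qed
  have F_sets: "{w. D j w \<and> (\<forall>k. gw z (N + j + k) w \<in> {m. set_mset m \<inter> A = {}})} \<in> sets ?S" for j
  proof -
    have "{w. \<forall>n. n \<ge> N + j \<longrightarrow> gw z n w \<in> {m. set_mset m \<inter> A = {}}} \<in> sets ?S"
      by (rule sets_gw_ball)
    moreover have "{w. \<forall>n. n \<ge> N + j \<longrightarrow> gw z n w \<in> {m. set_mset m \<inter> A = {}}} =
        {w. \<forall>k. gw z (N + j + k) w \<in> {m. set_mset m \<inter> A = {}}}"
      by (auto simp: le_iff_add)
    ultimately show ?thesis using D_sets[of j] by (simp add: Collect_conj_eq)
  qed
  \<comment> \<open>Any one individual \<open>y\<close> of \<open>m\<close> suffices: by coupling,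
    its descendants are among those of \<open>m\<close>, so they avoid \<open>A\<close> whenever all
    descendants of \<open>m\<close> do.\<close>
  have start: "measure ?S {w. \<forall>k. gw m k w \<in> {m. set_mset m \<inter> A = {}}} \<le> c" if ne: "m \<noteq> {#}" for m
  proof -
    obtain y where y: "y \<in># m" by (rule multiset_nonemptyE[OF ne])
    then have "{w. \<forall>k. gw m k w \<in> {m. set_mset m \<inter> A = {}}} \<subseteq>
        {w. \<forall>k. set_mset (gw {#y#} k w) \<inter> A = {}}"
      using set_mset_mono[OF gw_mono, of "{#y#}" m] by fastforce
    then have "measure ?S {w. \<forall>k. gw m k w \<in> {m. set_mset m \<inter> A = {}}} \<le>
        measure ?S {w. \<forall>k. set_mset (gw {#y#} k w) \<inter> A = {}}"
      using sets_gw_ball[of "\<lambda>_. True" "\<lambda>m. set_mset m \<inter> A = {}" "{#y#}" p]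
      by (intro S.finite_measure_mono) auto
    also have "\<dots> \<le> c" by (rule bound)
    finally show ?thesis .
  qed
  have le: "measure ?S ?F \<le> c * measure ?S {w. D j w}" for j
  proof -
    have "measure ?S ?F \<le>
        measure ?S {w. D j w \<and> (\<forall>k. gw z (N + j + k) w \<in> {m. set_mset m \<inter> A = {}})}"
    proof (intro S.finite_measure_mono F_sets subsetI)
      fix w assume "w \<in> ?F"
      then have "gw z n w \<noteq> {#}" "n \<ge> N \<Longrightarrow> set_mset (gw z n w) \<inter> A = {}" for n
        by simp_all
      then show "w \<in> {w. D j w \<and> (\<forall>k. gw z (N + j + k) w \<in> {m. set_mset m \<inter> A = {}})}"
        by (simp add: D_def)
    qed
    also have "\<dots> \<le> c * measure ?S {w. D j w}"
      by (rule markov_bound[OF D_sets]) (auto simp: D_def gw_comb_seq_le intro!: start[simplified])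
    finally show ?thesis .
  qed
  have "decseq (\<lambda>j. {w. D j w})"
    unfolding decseq_def D_def using gw_empty[of z] by fastforce
  then have "(\<lambda>j. measure ?S {w. D j w}) \<longlonglongrightarrow> measure ?S (\<Inter>j. {w. D j w})"
    using D_sets by (intro S.finite_Lim_measure_decseq) auto
  moreover have "(\<Inter>j. {w. D j w}) = ?F"
  proof (intro set_eqI iffI)
    fix w assume "w \<in> (\<Inter>j. {w. D j w})"
    then have D: "D j w" for j by auto
    have "gw z n w \<noteq> {#}" for n
      using D[of n] gw_empty[of z n w "N + n"] by (auto simp: D_def)
    moreover have "set_mset (gw z n w) \<inter> A = {}" if "n \<ge> N" for n
      using D[of n] that unfolding D_def by simp
    ultimately show "w \<in> ?F" by simp
  qed (auto simp: D_def)
  ultimately have "(\<lambda>j. c * measure ?S {w. D j w}) \<longlonglongrightarrow> c * measure ?S ?F"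
    by (intro tendsto_mult) auto
  \<comment> \<open>The bound \<open>le\<close> passes to the limit; as \<open>c < 1\<close>, the
    resulting inequality leaves only probability 0.\<close>
  then have "measure ?S ?F \<le> c * measure ?S ?F"
    by (rule LIMSEQ_le_const) (use le in auto)
  then have "(1 - c) * measure ?S ?F \<le> 0" by (simp add: algebra_simps)
  with \<open>c < 1\<close> show ?thesis
    by (simp add: mult_le_0_iff measure_le_0_iff)
qed

section \<open>Transfer from the given process to the path space\<close>

context mgwbp
begin

text \<open>Independence over all triples \<open>(n, y, i)\<close> is regrouped by \<open>n\<close>:
  each block has law \<open>gen_space p\<close>, and blocks with different \<open>n\<close> are
  independent.\<close>

lemma distr_xi:
  "distr (P x) (path_space p) (\<lambda>\<omega> n (y, i). \<xi> n y i \<omega>) = path_space p"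
proof -
  interpret prob_space "P x" by (rule prob_space_P)
  let ?C = "\<lambda>_. count_space (UNIV :: 'x multiset set)"
  let ?X = "\<lambda>(n, y, i). \<xi> n y i"
  let ?Y = "\<lambda>n \<omega> (y, i). \<xi> n y i \<omega>"
  let ?q = "\<lambda>(n :: nat, y, i :: nat). measure_pmf (p y)"
  have rv: "random_variable (count_space UNIV) (?X k)" for k
    using offspring_indep[of x] unfolding indep_vars_def by blast
  have "distr (P x) (PiM UNIV ?C) (\<lambda>\<omega>. \<lambda>k\<in>UNIV. ?X k \<omega>) =
      PiM UNIV (\<lambda>k. distr (P x) (count_space UNIV) (?X k))"
    using indep_vars_iff_distr_eq_PiM'[of UNIV ?X ?C] rv offspring_indep[of x] by simp
  also have "\<dots> = PiM UNIV ?q"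
    by (intro PiM_cong) (auto simp: offspring_law)
  finally have joint: "distr (P x) (PiM UNIV ?C) (\<lambda>\<omega> k. ?X k \<omega>) = PiM UNIV ?q"
    by (simp only: restrict_UNIV)
  have rv_Y: "random_variable (gen_space p) (?Y n)" for n
    unfolding measurable_cong_sets[OF refl sets_gen_space]
    using rv by (intro measurable_PiM_single') (auto simp: case_prod_unfold)
  have law: "distr (P x) (gen_space p) (?Y n) = gen_space p" for n
  proof -
    \<comment> \<open>\<open>?r\<close> picks generation \<open>n\<close> out of the flat family, a
      reindexing along the injection \<open>(y, i) \<mapsto> (n, y, i)\<close>.\<close>
    let ?r = "\<lambda>e k. e (n, fst k, snd k)"
    have "gen_space p = distr (PiM UNIV ?q) (gen_space p) ?r"
      using distr_PiM_reindex[of UNIV ?q "\<lambda>k. (n, fst k, snd k)" UNIV]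
      by (auto simp: gen_space_def case_prod_unfold inj_on_def
          measure_pmf.prob_space_axioms restrict_UNIV)
    also have "\<dots> = distr (distr (P x) (PiM UNIV ?C) (\<lambda>\<omega> k. ?X k \<omega>)) (gen_space p) ?r"
      by (simp add: joint)
    also have "\<dots> = distr (P x) (gen_space p) (?r \<circ> (\<lambda>\<omega> k. ?X k \<omega>))"
    proof (rule distr_distr)
      show "?r \<in> measurable (PiM UNIV ?C) (gen_space p)"
        unfolding measurable_cong_sets[OF refl sets_gen_space]
        by (intro measurable_PiM_single') auto
      show "(\<lambda>\<omega> k. ?X k \<omega>) \<in> measurable (P x) (PiM UNIV ?C)"
        using rv by (intro measurable_PiM_single') auto
    qed
    also have "?r \<circ> (\<lambda>\<omega> k. ?X k \<omega>) = ?Y n"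
      by (auto simp: fun_eq_iff)
    finally show ?thesis ..
  qed
  \<comment> \<open>The index sets \<open>{n} \<times> UNIV\<close> are disjoint, so the blocks
    inherit independence.\<close>
  have "indep_vars (\<lambda>n. PiM ({n} \<times> UNIV) ?C) (\<lambda>n \<omega>. restrict (\<lambda>k. ?X k \<omega>) ({n} \<times> UNIV)) UNIV"
    by (rule indep_vars_restrict[OF offspring_indep]) (auto simp: disjoint_family_on_def)
  then have "indep_vars (\<lambda>_. gen_space p)
      (\<lambda>n \<omega>. (\<lambda>e k. e (n, fst k, snd k)) (restrict (\<lambda>k. ?X k \<omega>) ({n} \<times> UNIV))) UNIV"
  proof (rule indep_vars_compose2)
    show "(\<lambda>e k. e (n, fst k, snd k)) \<in> measurable (PiM ({n} \<times> UNIV) ?C) (gen_space p)" for n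
      unfolding measurable_cong_sets[OF refl sets_gen_space]
      by (intro measurable_PiM_single') auto
  qed
  then have "indep_vars (\<lambda>_. gen_space p) ?Y UNIV"
    by (simp add: case_prod_unfold)
  then have "distr (P x) (PiM UNIV (\<lambda>_. gen_space p)) (\<lambda>\<omega>. \<lambda>n\<in>UNIV. ?Y n \<omega>) =
      PiM UNIV (\<lambda>n. distr (P x) (gen_space p) (?Y n))"
    using indep_vars_iff_distr_eq_PiM'[of UNIV ?Y "\<lambda>_. gen_space p"] rv_Y by simp
  then show ?thesis by (simp add: law path_space_def restrict_UNIV)
qed

lemma measurable_xi:
  "(\<lambda>\<omega> n (y, i). \<xi> n y i \<omega>) \<in> measurable (P x) (path_space p)"
proof -
  interpret prob_space "P x" by (rule prob_space_P)
  have "\<xi> n y i \<in> measurable (P x) (count_space UNIV)" for n y i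
    using offspring_indep[of x] by (fastforce simp: indep_vars_def)
  then have "(\<lambda>\<omega> (y, i). \<xi> n y i \<omega>) \<in> measurable (P x) (gen_space p)" for n
    unfolding measurable_cong_sets[OF refl sets_gen_space]
    by (intro measurable_PiM_single') (auto simp: case_prod_unfold)
  then show ?thesis
    unfolding path_space_def by (intro measurable_PiM_single') auto
qed

text \<open>The countably many almost sure recursions hold together off one null set, where
  induction on \<open>n\<close> runs pathwise.\<close>

lemma AE_Z_eq_gw:
  "AE \<omega> in P x. \<forall>n. Z n \<omega> = gw {#x#} n (\<lambda>n (y, i). \<xi> n y i \<omega>)"
proof -
  have "AE \<omega> in P x. \<forall>n. Z (Suc n) \<omega> =
      (\<Sum>y\<in>set_mset (Z n \<omega>). \<Sum>i<count (Z n \<omega>) y. \<xi> n y i \<omega>)"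
    using Z_Suc by (simp add: AE_all_countable)
  with Z_0[of x] show ?thesis
  proof eventually_elim
    case (elim \<omega>)
    have "Z n \<omega> = gw {#x#} n (\<lambda>n (y, i). \<xi> n y i \<omega>)" for n
      by (induction n) (auto simp: elim offspring_def)
    then show ?case ..
  qed
qed

lemma sets_extinct_gw: "{w. extinct (gw {#x#}) A w} \<in> sets (path_space p)"
proof -
  have "Measurable.pred (path_space p)
      (\<lambda>w. \<exists>N. \<forall>n. n \<ge> N \<longrightarrow> (\<forall>y\<in>A. count (gw {#x#} n w) y = 0))"
    by measurable
  then show ?thesis by (simp add: extinct_iff pred_def)
qed

text \<open>Replaces the separate measures \<open>P x\<close> by one common measure, with
  \<open>x\<close> entering only as the starting state. This lets the bound for every type be
  applied after a restart.\<close>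

lemma ext_prob_eq_gw:
  "ext_prob P Z A x = measure (path_space p) {w. extinct (gw {#x#}) A w}"
proof -
  let ?g = "\<lambda>\<omega> n (y, i). \<xi> n y i \<omega>"
  have "measure (path_space p) {w. extinct (gw {#x#}) A w} =
      measure (distr (P x) (path_space p) ?g) {w. extinct (gw {#x#}) A w}"
    by (simp add: distr_xi)
  also have "\<dots> = measure (P x) (?g -` {w. extinct (gw {#x#}) A w} \<inter> space (P x))"
    by (rule measure_distr[OF measurable_xi sets_extinct_gw])
  also have "\<dots> = ext_prob P Z A x"
    unfolding ext_prob_def
  proof (rule measure_eq_AE)
    show "AE \<omega> in P x. (\<omega> \<in> ?g -` {w. extinct (gw {#x#}) A w} \<inter> space (P x)) =
        (\<omega> \<in> {\<omega> \<in> space (P x). extinct Z A \<omega>})"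
      using AE_Z_eq_gw[of x] by eventually_elim (auto simp: extinct_iff)
  qed (rule measurable_sets[OF measurable_xi sets_extinct_gw] extinct_in_sets)+
  finally show ?thesis ..
qed

section \<open>Equality of the extinction probabilities\<close>

lemma ext_prob_eq_global:
  assumes bound: "\<And>y. ext_prob P Z A y \<le> c" and "c < 1"
  shows "ext_prob P Z A x = ext_prob P Z UNIV x"
proof -
  let ?S = "path_space p" and ?E = "\<lambda>A. {w. extinct (gw {#x#}) A w}"
  let ?F = "\<lambda>N. {w. (\<forall>n. gw {#x#} n w \<noteq> {#}) \<and> (\<forall>n\<ge>N. set_mset (gw {#x#} n w) \<inter> A = {})}"
  interpret S: prob_space ?S by (rule prob_space_path_space)
  have avoid: "measure ?S {w. \<forall>k. set_mset (gw {#y#} k w) \<inter> A = {}} \<le> c" for y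
  proof -
    \<comment> \<open>Avoiding \<open>A\<close> in all generations is a special case of extinction
      in \<open>A\<close>.\<close>
    have "{w. \<forall>k. set_mset (gw {#y#} k w) \<inter> A = {}} \<subseteq> {w. extinct (gw {#y#}) A w}"
      by (auto simp: extinct_iff not_in_iff[symmetric])
    then have "measure ?S {w. \<forall>k. set_mset (gw {#y#} k w) \<inter> A = {}} \<le> ext_prob P Z A y"
      unfolding ext_prob_eq_gw by (rule S.finite_measure_mono) (rule sets_extinct_gw)
    with bound[of y] show ?thesis by linarith
  qed
  have "?F N \<in> null_sets ?S" for N
  proof -
    have "?F N \<in> sets ?S"
      using sets_gw_ball[of "\<lambda>_. True" "\<lambda>m. m \<noteq> {#}" "{#x#}" p]
        sets_gw_ball[of "\<lambda>n. n \<ge> N" "\<lambda>m. set_mset m \<inter> A = {}" "{#x#}" p]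
      by (simp add: Collect_conj_eq)
    with measure_survive_avoid_eq_0[OF avoid \<open>c < 1\<close>] show ?thesis
      by (simp add: null_sets_def S.emeasure_eq_measure)
  qed
  \<comment> \<open>Extinction in \<open>A\<close> means avoiding \<open>A\<close> from some
    \<open>N\<close> on; countably many \<open>N\<close> keep the exceptional set null.\<close>
  then have "AE w in ?S. \<forall>N. w \<notin> ?F N"
    unfolding AE_all_countable using AE_not_in by blast
  then have "AE w in ?S. w \<in> ?E A \<longleftrightarrow> w \<in> ?E UNIV"
  proof eventually_elim
    case (elim w)
    show ?case
    proof
      assume "w \<in> ?E A"
      then obtain N where "\<forall>n\<ge>N. set_mset (gw {#x#} n w) \<inter> A = {}"
        by (auto simp: extinct_iff not_in_iff[symmetric])
      with elim obtain n where "gw {#x#} n w = {#}" by blast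
      then have "\<forall>m\<ge>n. gw {#x#} m w = {#}" using gw_empty by blast
      then show "w \<in> ?E UNIV" unfolding extinct_iff by (auto intro!: exI[of _ n])
    qed (auto simp: extinct_iff)
  qed
  then have "measure ?S (?E A) = measure ?S (?E UNIV)"
    by (intro measure_eq_AE sets_extinct_gw)
  then show ?thesis by (simp add: ext_prob_eq_gw)
qed

end

theorem corollary2:
  fixes P :: "'x::countable \<Rightarrow> 'w measure"
    and p :: "'x \<Rightarrow> 'x multiset pmf"
    and \<xi> :: "nat \<Rightarrow> 'x \<Rightarrow> nat \<Rightarrow> 'w \<Rightarrow> 'x multiset"
    and Z :: "nat \<Rightarrow> 'w \<Rightarrow> 'x multiset"
    and A :: "'x set"
  assumes "mgwbp P p \<xi> Z"
    and "ext_prob P Z A \<noteq> ext_prob P Z UNIV"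
  shows "(SUP x. ext_prob P Z A x) = 1"
proof (rule ccontr)
  interpret mgwbp P p \<xi> Z by fact
  have le1: "ext_prob P Z A x \<le> 1" for x
    unfolding ext_prob_def by (rule prob_space.prob_le_1[OF prob_space_P])
  then have bdd: "bdd_above (range (ext_prob P Z A))"
    by (intro bdd_aboveI2)
  assume "(SUP x. ext_prob P Z A x) \<noteq> 1"
  moreover have "(SUP x. ext_prob P Z A x) \<le> 1" using le1 by (auto intro: cSUP_least)
  ultimately have "(SUP x. ext_prob P Z A x) < 1" by simp
  \<comment> \<open>The supremum itself serves as \<open>c\<close>; it is an upper bound because the
    probabilities are bounded by 1.\<close>
  then have "ext_prob P Z A x = ext_prob P Z UNIV x" for x
    using ext_prob_eq_global[OF cSUP_upper[OF UNIV_I bdd]] by blast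
  with assms(2) show False by (simp add: fun_eq_iff)
qed

end
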